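(* 1) The maximal tail concordance measure $\lambda^\ast:\mathcal L\to\mathbb R_+$, $\lambda^\ast(\Lambda)=\sup_{b\in(0,\infty)}\Lambda(b,1/b)$, is a strict and convex TCM. 2) For every $\mu\in\mathcal M$, the $\mu$-average tail concordance measure $\lambda_\mu:\mathcal L\to\mathbb R_+$, $$\lambda_\mu(\Lambda)=\frac{\int_{(0,\infty)}\Lambda(b,1/b)\,\mathrm d\mu(b)}{\int_{(0,\infty)}\overline\Lambda(b,1/b)\,\mathrm d\mu(b)},$$ is a linear TCM. 3) The $\mu$-average tail concordance measure $\lambda_\mu$ is strict if $\mu\in\mathcal M$ satisfies $$\mu\big((1-\epsilon,1+\epsilon)\cap(0,\infty)\big)>0\quad\text{for any }\epsilon>0.$$
   Context: $\mathbb R_+=[0,\infty)$. A 2-copula is a bivariate distribution function on $[0,1]^2$ with standard uniform margins; $\mathcal C_2$ is the set of all 2-copulas. $\mathcal L$ is the set of all tail copulas, i.e. of all functions $\Lambda:\mathbb R_+^2\to\mathbb R_+$ for which there exists $C\in\mathcal C_2$ such that $\Lambda(u,v)=\lim_{p\downarrow0}C(pu,pv)/p$ for every $(u,v)\in\mathbb R_+^2$ (the limit existing for every $(u,v)$). Write $\overline\Lambda(u,v)=\min(u,v)$, which belongs to $\mathcal L$. $\Lambda\in\mathcal L$ is tail independent if $\Lambda\equiv0$, and tail comonotonic if $\Lambda=\overline\Lambda$. For $\Lambda,\Lambda'\in\mathcal L$, write $\Lambda\preceq\Lambda'$ if $\Lambda(u,v)\le\Lambda'(u,v)$ for all $(u,v)\in\mathbb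 R_+^2$. A map $\kappa:\mathcal L\to\mathbb R$ is a tail concordance measure (TCM) if: (i) $\kappa(\Lambda)=1$ if $\Lambda$ is tail comonotonic; (ii) $\kappa(\Lambda)=0$ if and only if $\Lambda$ is tail independent; (iii) $\Lambda\preceq\Lambda'$ with $\Lambda,\Lambda'\in\mathcal L$ implies $\kappa(\Lambda)\le\kappa(\Lambda')$; (iv) if $\Lambda^{[n]}\to\Lambda$ pointwise as $n\to\infty$, with $\Lambda^{[n]},\Lambda\in\mathcal L$, then $\lim_{n\to\infty}\kappa(\Lambda^{[n]})=\kappa(\Lambda)$. A TCM $\kappa$ is strict if, in addition, $\kappa(\Lambda)=1$ and $\Lambda=\overline\Lambda$ are equivalent. A TCM $\kappa$ is convex if $\kappa(t\Lambda+(1-t)\Lambda')\le t\kappa(\Lambda)+(1-t)\kappa(\Lambda')$ for all $\Lambda,\Lambda'\in\mathcal L$ and $t\in[0,1]$; concave if the reverse inequality always holds; linear if it is both convex and concave. (The set $\mathcal L$ is convex.) $\mathcal M$ is the set of all Borel probability measures $\mu$ on $(0,\infty)$ such that $\int_{(0,\infty)}\overline\Lambda(b,1/b)\,\mathrm d\mu(b)<\infty$. *)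

theory Defs
  imports "HOL-Probability.Probability"
begin

definition quadrant :: "(real \<times> real) set" where
  "quadrant = {0..} \<times> {0..}"

definition unit_square :: "(real \<times> real) set" where
  "unit_square = {0..1} \<times> {0..1}"

text \<open>Functions on the unit square or on the quadrant are extensional functions on
  \<open>real \<times> real\<close>, so that equality of such functions is equality on their domain.\<close>

definition copulas :: "(real \<times> real \<Rightarrow> real) set" where
  "copulas = {C \<in> extensional unit_square.
     \<exists>P :: (real \<times> real) measure.
       prob_space P \<and> sets P = sets borel \<and>
       distr P borel fst = uniform_measure lborel {0..1} \<and>
       distr P borel snd = uniform_measure lborel {0..1} \<and>
       (\<forall>(u, v)\<in>unit_square. C (u, v) = measure P ({..u} \<times> {..v}))}"

text \<open>For fixed \<open>(u, v)\<close> in the quadrant the point \<open>(p * u, p * v)\<close> lies in the unit square for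
  all small positive \<open>p\<close>, so the limit does not see the values of \<open>C\<close> outside.\<close>

definition tail_copulas :: "(real \<times> real \<Rightarrow> real) set" where
  "tail_copulas = {\<Lambda> \<in> quadrant \<rightarrow>\<^sub>E {0..}.
     \<exists>C\<in>copulas. \<forall>(u, v)\<in>quadrant.
       ((\<lambda>p. C (p * u, p * v) / p) \<longlongrightarrow> \<Lambda> (u, v)) (at_right 0)}"

definition max_tail_copula :: "real \<times> real \<Rightarrow> real" where
  "max_tail_copula = (\<lambda>(u, v)\<in>quadrant. min u v)"

definition tail_independent :: "(real \<times> real \<Rightarrow> real) \<Rightarrow> bool" where
  "tail_independent \<Lambda> \<longleftrightarrow> (\<forall>x\<in>quadrant. \<Lambda> x = 0)"

definition tail_comonotonic :: "(real \<times> real \<Rightarrow> real) \<Rightarrow> bool" where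
  "tail_comonotonic \<Lambda> \<longleftrightarrow> \<Lambda> = max_tail_copula"

definition tail_le :: "(real \<times> real \<Rightarrow> real) \<Rightarrow> (real \<times> real \<Rightarrow> real) \<Rightarrow> bool" where
  "tail_le \<Lambda> \<Lambda>' \<longleftrightarrow> (\<forall>x\<in>quadrant. \<Lambda> x \<le> \<Lambda>' x)"

definition tail_mix ::
  "real \<Rightarrow> (real \<times> real \<Rightarrow> real) \<Rightarrow> (real \<times> real \<Rightarrow> real) \<Rightarrow> real \<times> real \<Rightarrow> real" where
  "tail_mix t \<Lambda> \<Lambda>' = (\<lambda>x\<in>quadrant. t * \<Lambda> x + (1 - t) * \<Lambda>' x)"

text \<open>Maps on the set of tail copulas are total functions \<open>\<kappa>\<close>; the notions below only
  constrain their values on \<open>tail_copulas\<close>, which contains all mixtures of its elements.\<close>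

definition tcm :: "((real \<times> real \<Rightarrow> real) \<Rightarrow> real) \<Rightarrow> bool" where
  "tcm \<kappa> \<longleftrightarrow>
     (\<forall>\<Lambda>\<in>tail_copulas. tail_comonotonic \<Lambda> \<longrightarrow> \<kappa> \<Lambda> = 1) \<and>
     (\<forall>\<Lambda>\<in>tail_copulas. \<kappa> \<Lambda> = 0 \<longleftrightarrow> tail_independent \<Lambda>) \<and>
     (\<forall>\<Lambda>\<in>tail_copulas. \<forall>\<Lambda>'\<in>tail_copulas. tail_le \<Lambda> \<Lambda>' \<longrightarrow> \<kappa> \<Lambda> \<le> \<kappa> \<Lambda>') \<and>
     (\<forall>\<Lambda>n :: nat \<Rightarrow> real \<times> real \<Rightarrow> real. \<forall>\<Lambda>\<in>tail_copulas.
        (\<forall>n. \<Lambda>n n \<in> tail_copulas) \<longrightarrow>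
        (\<forall>x\<in>quadrant. (\<lambda>n. \<Lambda>n n x) \<longlonglongrightarrow> \<Lambda> x) \<longrightarrow>
        (\<lambda>n. \<kappa> (\<Lambda>n n)) \<longlonglongrightarrow> \<kappa> \<Lambda>)"

definition strict_tcm :: "((real \<times> real \<Rightarrow> real) \<Rightarrow> real) \<Rightarrow> bool" where
  "strict_tcm \<kappa> \<longleftrightarrow> tcm \<kappa> \<and> (\<forall>\<Lambda>\<in>tail_copulas. \<kappa> \<Lambda> = 1 \<longleftrightarrow> \<Lambda> = max_tail_copula)"

definition convex_tcm :: "((real \<times> real \<Rightarrow> real) \<Rightarrow> real) \<Rightarrow> bool" where
  "convex_tcm \<kappa> \<longleftrightarrow> tcm \<kappa> \<and>
     (\<forall>\<Lambda>\<in>tail_copulas. \<forall>\<Lambda>'\<in>tail_copulas. \<forall>t\<in>{0..1}.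
        \<kappa> (tail_mix t \<Lambda> \<Lambda>') \<le> t * \<kappa> \<Lambda> + (1 - t) * \<kappa> \<Lambda>')"

definition concave_tcm :: "((real \<times> real \<Rightarrow> real) \<Rightarrow> real) \<Rightarrow> bool" where
  "concave_tcm \<kappa> \<longleftrightarrow> tcm \<kappa> \<and>
     (\<forall>\<Lambda>\<in>tail_copulas. \<forall>\<Lambda>'\<in>tail_copulas. \<forall>t\<in>{0..1}.
        \<kappa> (tail_mix t \<Lambda> \<Lambda>') \<ge> t * \<kappa> \<Lambda> + (1 - t) * \<kappa> \<Lambda>')"

definition linear_tcm :: "((real \<times> real \<Rightarrow> real) \<Rightarrow> real) \<Rightarrow> bool" where
  "linear_tcm \<kappa> \<longleftrightarrow> convex_tcm \<kappa> \<and> concave_tcm \<kappa>"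

definition averaging_measures :: "real measure set" where
  "averaging_measures = {\<mu>. prob_space \<mu> \<and> sets \<mu> = sets (restrict_space borel {0<..}) \<and>
     (\<integral>\<^sup>+ b. ennreal (max_tail_copula (b, 1 / b)) \<partial>\<mu>) < \<infinity>}"

definition lambda_max :: "(real \<times> real \<Rightarrow> real) \<Rightarrow> real" where
  "lambda_max \<Lambda> = (SUP b\<in>{0<..}. \<Lambda> (b, 1 / b))"

definition lambda_avg :: "real measure \<Rightarrow> (real \<times> real \<Rightarrow> real) \<Rightarrow> real" where
  "lambda_avg \<mu> \<Lambda> =
     (\<integral> b. \<Lambda> (b, 1 / b) \<partial>\<mu>) / (\<integral> b. max_tail_copula (b, 1 / b) \<partial>\<mu>)"

end

theory Submission imports Defs begin

text \<open>Everything rests on one inequality: \<open>\<Lambda> (u, v) \<le> s * \<Lambda> (x, y)\<close> whenever \<open>u \<le> s * x\<close> and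
  \<open>v \<le> s * y\<close>. Hence a zero of \<open>\<Lambda>\<close> at one point of the hyperbola \<open>(b, 1 / b)\<close> forces \<open>\<Lambda> = 0\<close>,
  and together with \<open>\<Lambda> \<le> min\<close> it gives \<open>(\<Lambda> (b, 1 / b))\<^sup>2 \<le> \<Lambda> (1, 1)\<close>, so that strictness
  reduces to the value at \<open>(1, 1)\<close>. It also makes tail copulas equicontinuous along the hyperbola;
  as they vanish uniformly at its ends, compactness yields the continuity of the supremum, while
  the averages are handled by dominated convergence.\<close>

section \<open>Copulas on the unit square\<close>

lemma copula_mono:
  assumes "C \<in> copulas" "0 \<le> u" "u \<le> u'" "u' \<le> 1" "0 \<le> v" "v \<le> v'" "v' \<le> 1"
  shows "C (u, v) \<le> C (u', v')"
proof -
  obtain P :: "(real \<times> real) measure" where P: "prob_space P" "sets P = sets borel"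
    "\<And>u v. (u, v) \<in> unit_square \<Longrightarrow> C (u, v) = measure P ({..u} \<times> {..v})"
    using assms(1) unfolding copulas_def by fastforce
  interpret prob_space P by (rule P(1))
  have "measure P ({..u} \<times> {..v}) \<le> measure P ({..u'} \<times> {..v'})"
    using assms by (intro finite_measure_mono) (auto simp: P(2) borel_prod[symmetric])
  then show ?thesis
    using assms by (simp add: P(3) unit_square_def)
qed

text \<open>The box of a copula value lies in a vertical and in a horizontal strip, whose masses are
  read off the uniform margins.\<close>

lemma copula_le_min:
  assumes "C \<in> copulas" "u \<in> {0..1}" "v \<in> {0..1}"
  shows "C (u, v) \<le> min u v"
proof -
  obtain P :: "(real \<times> real) measure" where P: "prob_space P" "sets P = sets borel"
    "distr P borel fst = uniform_measure lborel {0..1}"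
    "distr P borel snd = uniform_measure lborel {0..1}"
    "\<And>u v. (u, v) \<in> unit_square \<Longrightarrow> C (u, v) = measure P ({..u} \<times> {..v})"
    using assms(1) unfolding copulas_def by fastforce
  interpret prob_space P by (rule P(1))
  have meas: "fst \<in> P \<rightarrow>\<^sub>M borel" "snd \<in> P \<rightarrow>\<^sub>M borel"
    by (auto simp: measurable_cong_sets[OF P(2) refl] borel_prod[symmetric])
  have uniform: "measure (uniform_measure lborel {0..1}) {..w} = w" if "w \<in> {0..1}" for w :: real
  proof -
    have "{0..1} \<inter> {..w} = {0..w}" using that by auto
    then show ?thesis using that by (simp add: measure_uniform_measure)
  qed
  have "measure P ({..u} \<times> {..v}) \<le> measure P (fst -` {..u} \<inter> space P)"
    using sets_eq_imp_space_eq[OF P(2)] by (intro finite_measure_mono measurable_sets[OF meas(1)]) auto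
  also have "\<dots> = u"
    using uniform[OF assms(2)] meas by (simp add: P(3)[symmetric] measure_distr)
  finally have 1: "measure P ({..u} \<times> {..v}) \<le> u" .
  have "measure P ({..u} \<times> {..v}) \<le> measure P (snd -` {..v} \<inter> space P)"
    using sets_eq_imp_space_eq[OF P(2)] by (intro finite_measure_mono measurable_sets[OF meas(2)]) auto
  also have "\<dots> = v"
    using uniform[OF assms(3)] meas by (simp add: P(4)[symmetric] measure_distr)
  finally show ?thesis
    using 1 assms by (simp add: P(5) unit_square_def)
qed

text \<open>Copulas are controlled only on the unit square; this puts the points met by the limit
  \<open>p\<close> to 0 inside it.\<close>

lemma eventually_scaled_in_unit_interval:
  fixes u :: real
  assumes "0 \<le> u"
  shows "\<forall>\<^sub>F p in at_right 0. 0 \<le> p * u \<and> p * u \<le> 1"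
proof -
  have "((\<lambda>p. p * u) \<longlongrightarrow> 0 * u) (at_right 0)"
    by (intro tendsto_intros)
  then have "\<forall>\<^sub>F p in at_right 0. p * u < 1"
    by (rule order_tendstoD) simp
  then show ?thesis
    using eventually_at_right_less[of 0]
    by eventually_elim (use assms in auto)
qed

section \<open>Bounds and scaling for tail copulas\<close>

lemma tail_copula_le_min:
  assumes "\<Lambda> \<in> tail_copulas" "0 \<le> u" "0 \<le> v"
  shows "\<Lambda> (u, v) \<le> min u v"
proof -
  obtain C where C: "C \<in> copulas"
    "((\<lambda>p. C (p * u, p * v) / p) \<longlongrightarrow> \<Lambda> (u, v)) (at_right 0)"
    using assms unfolding tail_copulas_def quadrant_def by fastforce
  have "\<forall>\<^sub>F p in at_right 0. C (p * u, p * v) / p \<le> min u v"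
    using eventually_scaled_in_unit_interval[OF assms(2)]
      eventually_scaled_in_unit_interval[OF assms(3)] eventually_at_right_less[of 0]
  proof eventually_elim
    case (elim p)
    have "C (p * u, p * v) \<le> min (p * u) (p * v)"
      using elim by (intro copula_le_min C(1)) auto
    also have "\<dots> = p * min u v"
      using elim by (auto simp: min_def)
    finally show ?case
      using elim by (metis mult.commute pos_divide_le_eq)
  qed
  then show ?thesis
    by (intro tendsto_upperbound[OF C(2)]) auto
qed

lemma tail_copula_nonneg:
  assumes "\<Lambda> \<in> tail_copulas" "0 \<le> u" "0 \<le> v"
  shows "0 \<le> \<Lambda> (u, v)"
  using assms by (auto simp: tail_copulas_def quadrant_def PiE_iff)

text \<open>Replacing \<open>p\<close> by \<open>p * s\<close> in the limit that defines
  \<open>\<Lambda> (x, y)\<close> pulls out the factor \<open>s\<close>; monotonicity of the copula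
  then compares the two quotients. A single inequality thus carries both homogeneity and
  monotonicity.\<close>

lemma tail_copula_le_scaled:
  assumes "\<Lambda> \<in> tail_copulas" "0 < s" "0 \<le> u" "u \<le> s * x" "0 \<le> v" "v \<le> s * y"
  shows "\<Lambda> (u, v) \<le> s * \<Lambda> (x, y)"
proof -
  have "0 \<le> s * x" "0 \<le> s * y" using assms(3-) by linarith+
  then have xy: "0 \<le> x" "0 \<le> y" using assms(2) by (auto simp: zero_le_mult_iff)
  obtain C where C: "C \<in> copulas"
    "\<And>u v. 0 \<le> u \<Longrightarrow> 0 \<le> v \<Longrightarrow> ((\<lambda>p. C (p * u, p * v) / p) \<longlongrightarrow> \<Lambda> (u, v)) (at_right 0)"
    using assms(1) unfolding tail_copulas_def quadrant_def by fastforce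
  have scale: "filterlim (\<lambda>p. p * s) (at_right 0) (at_right 0)"
  proof -
    have "((\<lambda>p. p * s) \<longlongrightarrow> 0 * s) (at_right 0)"
      by (intro tendsto_intros)
    moreover have "\<forall>\<^sub>F p in at_right 0. p * s \<in> {0<..} \<and> p * s \<noteq> 0"
      using eventually_at_right_less[of 0] by eventually_elim (use assms(2) in auto)
    ultimately show ?thesis
      by (simp add: filterlim_at)
  qed
  \<comment> \<open>The factor \<open>s\<close> cancels inside, leaving
    \<open>C (p * s * x, p * s * y) / p\<close>, which has the same denominator as the quotient for
    \<open>(u, v)\<close>.\<close>
  have lim: "((\<lambda>p. s * (C (p * s * x, p * s * y) / (p * s))) \<longlongrightarrow> s * \<Lambda> (x, y)) (at_right 0)"
    by (intro tendsto_mult tendsto_const filterlim_compose[OF C(2)[OF xy] scale])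
  have "\<forall>\<^sub>F p in at_right 0.
      C (p * u, p * v) / p \<le> s * (C (p * s * x, p * s * y) / (p * s))"
    using eventually_scaled_in_unit_interval[OF \<open>0 \<le> s * x\<close>]
      eventually_scaled_in_unit_interval[OF \<open>0 \<le> s * y\<close>] eventually_at_right_less[of 0]
  proof eventually_elim
    case (elim p)
    have "C (p * u, p * v) \<le> C (p * s * x, p * s * y)"
      using elim assms by (intro copula_mono C(1)) (auto simp: mult.assoc)
    then show ?case
      using elim assms(2) by (simp add: field_simps)
  qed
  then show ?thesis
    by (intro tendsto_le[OF _ lim C(2)[OF assms(3,5)]]) auto
qed

section \<open>Tail copulas along the hyperbola\<close>

lemma tail_copula_hyperbola_bounds:
  assumes "\<Lambda> \<in> tail_copulas" "0 < b"
  shows "0 \<le> \<Lambda> (b, 1 / b)" "\<Lambda> (b, 1 / b) \<le> min b (1 / b)" "\<Lambda> (b, 1 / b) \<le> 1"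
    and "norm (\<Lambda> (b, 1 / b)) \<le> max_tail_copula (b, 1 / b)"
proof -
  show 1: "0 \<le> \<Lambda> (b, 1 / b)" "\<Lambda> (b, 1 / b) \<le> min b (1 / b)"
    using assms tail_copula_nonneg tail_copula_le_min by auto
  have "min b (1 / b) \<le> 1"
    using assms(2) by (cases "b \<le> 1") (auto simp: min_le_iff_disj)
  with 1 show "\<Lambda> (b, 1 / b) \<le> 1" by linarith
  show "norm (\<Lambda> (b, 1 / b)) \<le> max_tail_copula (b, 1 / b)"
    using 1 assms(2) by (simp add: max_tail_copula_def quadrant_def)
qed

lemma tail_copula_eq_0_of_hyperbola:
  assumes "\<Lambda> \<in> tail_copulas" "0 < b" "\<Lambda> (b, 1 / b) = 0"
  shows "tail_independent \<Lambda>"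
  unfolding tail_independent_def
proof safe
  fix u v :: real assume "(u, v) \<in> quadrant"
  then have uv: "0 \<le> u" "0 \<le> v" by (auto simp: quadrant_def)
  \<comment> \<open>The factor makes \<open>(u, v)\<close> lie below \<open>s\<close> times
    \<open>(b, 1 / b)\<close>; the 1 keeps it positive when \<open>u = v = 0\<close>.\<close>
  define s where "s = max 1 (max (u / b) (v * b))"
  have "u / b \<le> s" "v * b \<le> s" by (auto simp: s_def)
  then have "u \<le> s * b" "v \<le> s * (1 / b)" using assms(2) by (simp_all add: field_simps)
  moreover have "0 < s" by (simp add: s_def)
  ultimately have "\<Lambda> (u, v) \<le> s * \<Lambda> (b, 1 / b)"
    using assms uv by (intro tail_copula_le_scaled)
  with assms tail_copula_nonneg[OF assms(1) uv] show "\<Lambda> (u, v) = 0" by simp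
qed

text \<open>With \<open>m\<close> the smaller coordinate, the larger one is \<open>1 / m\<close>, so
  \<open>(b, 1 / b)\<close> lies below \<open>1 / m\<close> times \<open>(1, 1)\<close> and scaling
  applies.\<close>

lemma tail_copula_le_diagonal:
  assumes "\<Lambda> \<in> tail_copulas" "0 < b"
  shows "min b (1 / b) * \<Lambda> (b, 1 / b) \<le> \<Lambda> (1, 1)"
proof -
  define m where "m = min b (1 / b)"
  have m: "0 < m" "m \<le> b" "m \<le> 1 / b" using assms(2) by (auto simp: m_def)
  have "m * b \<le> 1" "m * (1 / b) \<le> 1"
    using m assms(2) by (auto simp: field_simps)
  then have "b \<le> 1 / m" "1 / b \<le> 1 / m"
    using m(1) assms(2) by (simp_all add: field_simps)
  then have "\<Lambda> (b, 1 / b) \<le> (1 / m) * \<Lambda> (1, 1)"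
    using assms m by (intro tail_copula_le_scaled) auto
  then show ?thesis
    using m(1) by (simp add: m_def[symmetric] field_simps)
qed

text \<open>Bounding one factor of the square by \<open>min b (1 / b)\<close> removes
  \<open>b\<close> from the estimate, so that it survives taking a supremum.\<close>

lemma tail_copula_sq_le_diagonal:
  assumes "\<Lambda> \<in> tail_copulas" "0 < b"
  shows "(\<Lambda> (b, 1 / b))\<^sup>2 \<le> \<Lambda> (1, 1)"
proof -
  note bd = tail_copula_hyperbola_bounds[OF assms]
  have "(\<Lambda> (b, 1 / b))\<^sup>2 \<le> min b (1 / b) * \<Lambda> (b, 1 / b)"
    unfolding power2_eq_square by (intro mult_right_mono bd(1,2))
  with tail_copula_le_diagonal[OF assms] show ?thesis by linarith
qed

text \<open>For \<open>m = min u v > 0\<close> the point \<open>(1, 1)\<close> lies below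
  \<open>1 / m\<close> times \<open>(u, v)\<close>, so a value of 1 there pushes
  \<open>\<Lambda> (u, v)\<close> up to its upper bound \<open>m\<close>.\<close>

lemma tail_copula_eq_max_of_diagonal:
  assumes "\<Lambda> \<in> tail_copulas" "1 \<le> \<Lambda> (1, 1)"
  shows "\<Lambda> = max_tail_copula"
proof
  fix x :: "real \<times> real"
  obtain u v where x: "x = (u, v)" by (cases x)
  show "\<Lambda> x = max_tail_copula x"
  proof (cases "x \<in> quadrant")
    case True
    then have uv: "0 \<le> u" "0 \<le> v" by (auto simp: x quadrant_def)
    define m where "m = min u v"
    have "m \<le> \<Lambda> (u, v)"
    proof (cases "m = 0")
      case False
      then have "0 < m" using uv by (auto simp: m_def)
      have "m \<le> u" "m \<le> v" by (simp_all add: m_def)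
      then have "1 \<le> (1 / m) * u" "1 \<le> (1 / m) * v" using \<open>0 < m\<close> by simp_all
      then have "\<Lambda> (1, 1) \<le> (1 / m) * \<Lambda> (u, v)"
        using \<open>0 < m\<close> by (intro tail_copula_le_scaled assms(1)) auto
      then have "1 \<le> (1 / m) * \<Lambda> (u, v)" using assms(2) by linarith
      then show ?thesis using \<open>0 < m\<close> by (simp add: field_simps)
    qed (use tail_copula_nonneg[OF assms(1) uv] in simp)
    with tail_copula_le_min[OF assms(1) uv] have "\<Lambda> (u, v) = min u v"
      unfolding m_def by (rule antisym)
    with True show ?thesis by (simp add: x max_tail_copula_def)
  next
    case False
    \<comment> \<open>Off the quadrant both functions take the default value
      \<open>undefined\<close>.\<close>
    have "\<Lambda> \<in> extensional quadrant"
      using assms(1) unfolding tail_copulas_def PiE_iff by blast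
    then have "\<Lambda> x = undefined" using False by (rule extensional_arb)
    with False show ?thesis by (simp add: max_tail_copula_def)
  qed
qed

lemma max_tail_copula_hyperbola:
  "0 < b \<Longrightarrow> max_tail_copula (b, 1 / b) = min b (1 / b)"
  by (simp add: max_tail_copula_def quadrant_def)

lemma tail_mix_hyperbola:
  "0 < b \<Longrightarrow> tail_mix t \<Lambda> \<Lambda>' (b, 1 / b) = t * \<Lambda> (b, 1 / b) + (1 - t) * \<Lambda>' (b, 1 / b)"
  by (simp add: tail_mix_def quadrant_def)

section \<open>The maximal tail concordance measure\<close>

text \<open>On the reals \<open>SUP\<close> is a genuine upper bound only for sets bounded
  above.\<close>

lemma bdd_above_tail_copula_hyperbola:
  assumes "\<Lambda> \<in> tail_copulas"
  shows "bdd_above ((\<lambda>b. \<Lambda> (b, 1 / b)) ` {0<..})"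
  using tail_copula_hyperbola_bounds(3)[OF assms] by (intro bdd_aboveI[of _ 1]) auto

lemma lambda_max_upper:
  assumes "\<Lambda> \<in> tail_copulas" "0 < b"
  shows "\<Lambda> (b, 1 / b) \<le> lambda_max \<Lambda>"
  unfolding lambda_max_def
  using assms by (intro cSUP_upper bdd_above_tail_copula_hyperbola) auto

lemma lambda_max_least:
  assumes "\<And>b. 0 < b \<Longrightarrow> \<Lambda> (b, 1 / b) \<le> c"
  shows "lambda_max \<Lambda> \<le> c"
  unfolding lambda_max_def using assms by (intro cSUP_least) auto

lemma lambda_max_nonneg:
  assumes "\<Lambda> \<in> tail_copulas"
  shows "0 \<le> lambda_max \<Lambda>"
  using lambda_max_upper[OF assms, of 1] tail_copula_hyperbola_bounds(1)[OF assms, of 1] by simp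

lemma lambda_max_sq_le_diagonal:
  assumes "\<Lambda> \<in> tail_copulas"
  shows "(lambda_max \<Lambda>)\<^sup>2 \<le> \<Lambda> (1, 1)"
proof -
  have "lambda_max \<Lambda> \<le> sqrt (\<Lambda> (1, 1))"
    using tail_copula_sq_le_diagonal[OF assms]
    by (intro lambda_max_least real_le_rsqrt) auto
  then have "(lambda_max \<Lambda>)\<^sup>2 \<le> (sqrt (\<Lambda> (1, 1)))\<^sup>2"
    using lambda_max_nonneg[OF assms] by (intro power_mono) auto
  then show ?thesis
    using tail_copula_nonneg[OF assms, of 1 1] by simp
qed

text \<open>Pointwise convergence must be made uniform in \<open>b\<close>. On
  \<open>{a..1 / a}\<close> a finite subcover reduces it to finitely many points; outside,
  \<open>min b (1 / b) \<le> a\<close> bounds every \<open>\<Lambda>n n\<close> at once. For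
  \<open>a > 1\<close> the interval is empty and the second case covers all
  \<open>b\<close>.\<close>

lemma lambda_max_upper_semicontinuous:
  fixes \<Lambda>n :: "nat \<Rightarrow> real \<times> real \<Rightarrow> real"
  assumes "\<Lambda> \<in> tail_copulas" "\<And>n. \<Lambda>n n \<in> tail_copulas"
    and "\<And>x. x \<in> quadrant \<Longrightarrow> (\<lambda>n. \<Lambda>n n x) \<longlonglongrightarrow> \<Lambda> x"
    and "lambda_max \<Lambda> < a"
  shows "\<forall>\<^sub>F n in sequentially. lambda_max (\<Lambda>n n) \<le> a"
proof -
  have a: "0 < a" using lambda_max_nonneg[OF assms(1)] assms(4) by linarith
  \<comment> \<open>Near any \<open>c\<close> the value at \<open>c\<close> controls all \<open>\<Lambda>n n\<close> up to a factor \<open>r\<close> close to 1.\<close>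
  have "\<exists>r>1. \<forall>\<^sub>F n in sequentially. \<forall>b\<in>{c / r<..<c * r}. \<Lambda>n n (b, 1 / b) \<le> a"
    if "0 < c" for c
  proof -
    have less: "\<Lambda> (c, 1 / c) < a"
      using lambda_max_upper[OF assms(1) that] assms(4) by linarith
    \<comment> \<open>Since \<open>\<Lambda> (c, 1 / c) < a\<close> is strict, there is room for a
      factor \<open>r > 1\<close>.\<close>
    have "((\<lambda>r. r * \<Lambda> (c, 1 / c)) \<longlongrightarrow> 1 * \<Lambda> (c, 1 / c)) (at_right 1)"
      by (intro tendsto_intros)
    then have "\<forall>\<^sub>F r in at_right 1. r * \<Lambda> (c, 1 / c) < a"
      by (rule order_tendstoD) (use less in simp)
    then have "\<forall>\<^sub>F r in at_right 1. 1 < r \<and> r * \<Lambda> (c, 1 / c) < a"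
      using eventually_at_right_less[of 1] by eventually_elim auto
    then obtain r where r: "1 < r" "r * \<Lambda> (c, 1 / c) < a"
      using eventually_happens'[OF trivial_limit_at_right_real] by blast
    have "(\<lambda>n. r * \<Lambda>n n (c, 1 / c)) \<longlonglongrightarrow> r * \<Lambda> (c, 1 / c)"
      using that by (intro tendsto_intros assms(3)) (auto simp: quadrant_def)
    then have "\<forall>\<^sub>F n in sequentially. r * \<Lambda>n n (c, 1 / c) < a"
      by (rule order_tendstoD) (use r in simp)
    then have "\<forall>\<^sub>F n in sequentially. \<forall>b\<in>{c / r<..<c * r}. \<Lambda>n n (b, 1 / b) \<le> a"
    proof eventually_elim
      case (elim n)
      show ?case
      proof
        fix b assume b: "b \<in> {c / r<..<c * r}"
        moreover have "0 < c / r" using that r by simp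
        ultimately have "0 < b" by (auto intro: less_trans)
        \<comment> \<open>The multiplicative neighbourhood of \<open>c\<close> places both
          coordinates of \<open>(b, 1 / b)\<close> below \<open>r\<close> times those of
          \<open>(c, 1 / c)\<close>.\<close>
        have "c < b * r" "b < r * c"
          using b r(1) by (simp_all add: pos_divide_less_eq mult.commute)
        then have "1 / b \<le> r * (1 / c)"
          using that \<open>0 < b\<close> by (simp add: pos_divide_le_eq pos_le_divide_eq mult.commute)
        with \<open>b < r * c\<close> have "\<Lambda>n n (b, 1 / b) \<le> r * \<Lambda>n n (c, 1 / c)"
          using r(1) \<open>0 < b\<close> by (intro tail_copula_le_scaled assms(2)) auto
        with elim show "\<Lambda>n n (b, 1 / b) \<le> a" by simp
      qed
    qed
    with r show ?thesis by blast
  qed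
  then have "\<forall>c\<in>{0<..}. \<exists>r. 1 < r \<and>
      (\<forall>\<^sub>F n in sequentially. \<forall>b\<in>{c / r<..<c * r}. \<Lambda>n n (b, 1 / b) \<le> a)"
    by simp
  from bchoice[OF this] obtain r where r: "\<And>c. 0 < c \<Longrightarrow> 1 < r c"
    "\<And>c. 0 < c \<Longrightarrow>
      \<forall>\<^sub>F n in sequentially. \<forall>b\<in>{c / r c<..<c * r c}. \<Lambda>n n (b, 1 / b) \<le> a"
    by auto
  have "{a..1 / a} \<subseteq> (\<Union>c\<in>{a..1 / a}. {c / r c<..<c * r c})"
  proof
    fix c assume c: "c \<in> {a..1 / a}"
    then have "0 < c" using a by auto
    then have "c \<in> {c / r c<..<c * r c}"
      using r(1)[of c] by (simp add: pos_divide_less_eq)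
    with c show "c \<in> (\<Union>c\<in>{a..1 / a}. {c / r c<..<c * r c})" by blast
  qed
  then obtain K where K: "K \<subseteq> {a..1 / a}" "finite K"
    "{a..1 / a} \<subseteq> (\<Union>c\<in>K. {c / r c<..<c * r c})"
    by (rule compactE_image[OF compact_Icc open_greaterThanLessThan])
  \<comment> \<open>Finiteness of \<open>K\<close> allows one threshold for all its points, which
    are positive because \<open>0 < a\<close>.\<close>
  have "\<forall>\<^sub>F n in sequentially. \<forall>c\<in>K. \<forall>b\<in>{c / r c<..<c * r c}. \<Lambda>n n (b, 1 / b) \<le> a"
    using K a by (intro eventually_ball_finite ballI r(2)) auto
  then show ?thesis
  proof eventually_elim
    case (elim n)
    show ?case
    proof (rule lambda_max_least)
      fix b :: real assume "0 < b"
      show "\<Lambda>n n (b, 1 / b) \<le> a"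
      proof (cases "b \<in> {a..1 / a}")
        case True
        with K elim show ?thesis by blast
      next
        case False
        then consider "b < a" | "1 / a < b" by fastforce
        then have "min b (1 / b) \<le> a"
        proof cases
          case 2
          then have "1 / b \<le> a"
            using a \<open>0 < b\<close> by (simp add: pos_divide_less_eq pos_divide_le_eq mult.commute)
          then show ?thesis by (simp add: min_le_iff_disj)
        qed simp
        with tail_copula_hyperbola_bounds(2)[OF assms(2) \<open>0 < b\<close>, of n] show ?thesis by linarith
      qed
    qed
  qed
qed

text \<open>The lower half needs only one \<open>b\<close> whose value exceeds the given bound; the
  upper half is the semicontinuity above.\<close>

lemma lambda_max_continuous:
  fixes \<Lambda>n :: "nat \<Rightarrow> real \<times> real \<Rightarrow> real"
  assumes "\<Lambda> \<in> tail_copulas" "\<And>n. \<Lambda>n n \<in> tail_copulas"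
    and "\<And>x. x \<in> quadrant \<Longrightarrow> (\<lambda>n. \<Lambda>n n x) \<longlonglongrightarrow> \<Lambda> x"
  shows "(\<lambda>n. lambda_max (\<Lambda>n n)) \<longlonglongrightarrow> lambda_max \<Lambda>"
proof (rule order_tendstoI)
  fix a assume "a < lambda_max \<Lambda>"
  then obtain b where b: "0 < b" "a < \<Lambda> (b, 1 / b)"
    using lambda_max_least[of \<Lambda> a] by (metis not_le)
  have "(\<lambda>n. \<Lambda>n n (b, 1 / b)) \<longlonglongrightarrow> \<Lambda> (b, 1 / b)"
    using b by (intro assms(3)) (auto simp: quadrant_def)
  then have "\<forall>\<^sub>F n in sequentially. a < \<Lambda>n n (b, 1 / b)"
    using b(2) by (rule order_tendstoD)
  then show "\<forall>\<^sub>F n in sequentially. a < lambda_max (\<Lambda>n n)"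
    by eventually_elim (use lambda_max_upper[OF assms(2) b(1)] in \<open>auto intro: less_le_trans\<close>)
next
  fix a assume "lambda_max \<Lambda> < a"
  \<comment> \<open>Semicontinuity yields a non-strict bound, so an intermediate \<open>a'\<close>
    restores strictness.\<close>
  then obtain a' where a': "lambda_max \<Lambda> < a'" "a' < a" using dense by blast
  show "\<forall>\<^sub>F n in sequentially. lambda_max (\<Lambda>n n) < a"
    by (rule eventually_mono[OF lambda_max_upper_semicontinuous[OF assms a'(1)]])
      (use a' in auto)
qed

lemma lambda_max_tcm: "tcm lambda_max"
  unfolding tcm_def
proof (intro conjI ballI allI impI)
  fix \<Lambda> assume \<Lambda>: "\<Lambda> \<in> tail_copulas" "tail_comonotonic \<Lambda>"
  then have "\<Lambda> (1, 1 / 1) = 1"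
    using max_tail_copula_hyperbola[of 1] by (simp add: tail_comonotonic_def)
  then have "1 \<le> lambda_max \<Lambda>" using lambda_max_upper[OF \<Lambda>(1), of 1] by simp
  moreover have "lambda_max \<Lambda> \<le> 1"
    by (intro lambda_max_least tail_copula_hyperbola_bounds \<Lambda>)
  ultimately show "lambda_max \<Lambda> = 1" by simp
next
  fix \<Lambda> assume \<Lambda>: "\<Lambda> \<in> tail_copulas"
  show "lambda_max \<Lambda> = 0 \<longleftrightarrow> tail_independent \<Lambda>"
  proof
    assume "lambda_max \<Lambda> = 0"
    then have "\<Lambda> (1, 1 / 1) = 0"
      using lambda_max_upper[OF \<Lambda>, of 1] tail_copula_hyperbola_bounds(1)[OF \<Lambda>, of 1] by simp
    then show "tail_independent \<Lambda>"
      by (intro tail_copula_eq_0_of_hyperbola[OF \<Lambda>, of 1]) auto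
  next
    assume "tail_independent \<Lambda>"
    then have "lambda_max \<Lambda> \<le> 0"
      by (intro lambda_max_least) (auto simp: tail_independent_def quadrant_def)
    with lambda_max_nonneg[OF \<Lambda>] show "lambda_max \<Lambda> = 0" by simp
  qed
next
  fix \<Lambda> \<Lambda>' assume "\<Lambda> \<in> tail_copulas" "\<Lambda>' \<in> tail_copulas" "tail_le \<Lambda> \<Lambda>'"
  then show "lambda_max \<Lambda> \<le> lambda_max \<Lambda>'"
    by (intro lambda_max_least order_trans[OF _ lambda_max_upper[of \<Lambda>']])
      (auto simp: tail_le_def quadrant_def)
qed (rule lambda_max_continuous, auto)

lemma lambda_max_strict: "strict_tcm lambda_max"
  unfolding strict_tcm_def
proof (intro conjI ballI iffI)
  fix \<Lambda> assume "\<Lambda> \<in> tail_copulas" "lambda_max \<Lambda> = 1"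
  then show "\<Lambda> = max_tail_copula"
    \<comment> \<open>With \<open>lambda_max \<Lambda> = 1\<close> the square bound reads
      \<open>1 \<le> \<Lambda> (1, 1)\<close>.\<close>
    using lambda_max_sq_le_diagonal[of \<Lambda>] by (intro tail_copula_eq_max_of_diagonal) auto
next
  fix \<Lambda> assume "\<Lambda> \<in> tail_copulas" "\<Lambda> = max_tail_copula"
  then show "lambda_max \<Lambda> = 1"
    using lambda_max_tcm by (auto simp: tcm_def tail_comonotonic_def)
qed (rule lambda_max_tcm)

lemma lambda_max_convex: "convex_tcm lambda_max"
  unfolding convex_tcm_def
proof (intro conjI ballI)
  fix \<Lambda> \<Lambda>' and t :: real
  assume \<Lambda>: "\<Lambda> \<in> tail_copulas" "\<Lambda>' \<in> tail_copulas" and t: "t \<in> {0..1}"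
  show "lambda_max (tail_mix t \<Lambda> \<Lambda>') \<le> t * lambda_max \<Lambda> + (1 - t) * lambda_max \<Lambda>'"
    \<comment> \<open>\<open>lambda_max_least\<close> asks only for pointwise bounds, so it applies
      directly to the mixture.\<close>
    using t by (intro lambda_max_least)
      (auto simp: tail_mix_hyperbola intro!: add_mono mult_left_mono lambda_max_upper \<Lambda>)
qed (rule lambda_max_tcm)

section \<open>Average tail concordance measures\<close>

text \<open>On the hyperbola a tail copula equals \<open>\<Lambda> (b\<^sup>2, 1) / b\<close>, a quotient of monotone functions.\<close>

lemma tail_copula_hyperbola_measurable:
  assumes "\<Lambda> \<in> tail_copulas" "sets \<mu> = sets (restrict_space borel {0<..})"
  shows "(\<lambda>b. \<Lambda> (b, 1 / b)) \<in> borel_measurable \<mu>"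
proof -
  \<comment> \<open>The clamp \<open>max 0\<close> extends the monotone function from the half-line
    to all reals.\<close>
  have "mono (\<lambda>x. \<Lambda> (max 0 x, 1))"
    using tail_copula_le_scaled[OF assms(1), of 1] by (intro monoI) auto
  then have mono: "(\<lambda>x. \<Lambda> (max 0 x, 1)) \<in> borel_measurable borel"
    by (rule borel_measurable_mono)
  have "(\<lambda>b. (1 / b) * \<Lambda> (max 0 (b\<^sup>2), 1)) \<in> borel_measurable borel"
    by (intro borel_measurable_times measurable_compose[OF _ mono]) auto
  then have "(\<lambda>b. (1 / b) * \<Lambda> (max 0 (b\<^sup>2), 1)) \<in> borel_measurable \<mu>"
    unfolding measurable_cong_sets[OF assms(2) refl] by (rule measurable_restrict_space1)
  \<comment> \<open>Homogeneity appears as two scalings, one by \<open>1 / b\<close> and one by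
    \<open>b\<close>.\<close>
  moreover have "\<Lambda> (b, 1 / b) = (1 / b) * \<Lambda> (max 0 (b\<^sup>2), 1)" if "0 < b" for b
  proof (rule antisym)
    show "\<Lambda> (b, 1 / b) \<le> (1 / b) * \<Lambda> (max 0 (b\<^sup>2), 1)"
      using that by (intro tail_copula_le_scaled assms(1)) (auto simp: power2_eq_square)
    have "\<Lambda> (max 0 (b\<^sup>2), 1) \<le> b * \<Lambda> (b, 1 / b)"
      using that by (intro tail_copula_le_scaled assms(1)) (auto simp: power2_eq_square)
    then show "(1 / b) * \<Lambda> (max 0 (b\<^sup>2), 1) \<le> \<Lambda> (b, 1 / b)"
      using that by (simp add: field_simps)
  qed
  moreover have "space \<mu> = {0<..}"
    using sets_eq_imp_space_eq[OF assms(2)] by (simp add: space_restrict_space)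
  ultimately show ?thesis
    by (subst measurable_cong) auto
qed

locale averaging =
  fixes \<mu> :: "real measure"
  assumes averaging: "\<mu> \<in> averaging_measures"

sublocale averaging \<subseteq> prob_space \<mu>
  using averaging by (simp add: averaging_measures_def)

context averaging
begin

lemma sets_mu: "sets \<mu> = sets (restrict_space borel {0<..})"
  using averaging by (simp add: averaging_measures_def)

lemma space_mu: "space \<mu> = {0<..}"
  using sets_eq_imp_space_eq[OF sets_mu] by (simp add: space_restrict_space)

text \<open>This is the dominating function for every later integral; its measurability comes from
  the explicit formula \<open>min b (1 / b)\<close>.\<close>

lemma integrable_max: "integrable \<mu> (\<lambda>b. max_tail_copula (b, 1 / b))"
proof (rule integrableI_bounded)
  have "(\<lambda>b :: real. min b (1 / b)) \<in> borel_measurable borel" by measurable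
  then have "(\<lambda>b. min b (1 / b)) \<in> borel_measurable \<mu>"
    unfolding measurable_cong_sets[OF sets_mu refl] by (rule measurable_restrict_space1)
  then show "(\<lambda>b. max_tail_copula (b, 1 / b)) \<in> borel_measurable \<mu>"
    by (subst measurable_cong) (auto simp: space_mu max_tail_copula_hyperbola)
  have "(\<integral>\<^sup>+ b. ennreal (norm (max_tail_copula (b, 1 / b))) \<partial>\<mu>) =
      (\<integral>\<^sup>+ b. ennreal (max_tail_copula (b, 1 / b)) \<partial>\<mu>)"
    by (intro nn_integral_cong) (simp add: space_mu max_tail_copula_hyperbola)
  then show "(\<integral>\<^sup>+ b. ennreal (norm (max_tail_copula (b, 1 / b))) \<partial>\<mu>) < \<infinity>"
    using averaging by (simp add: averaging_measures_def)
qed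

lemma measurable_tail_copula:
  assumes "\<Lambda> \<in> tail_copulas"
  shows "(\<lambda>b. \<Lambda> (b, 1 / b)) \<in> borel_measurable \<mu>"
  using tail_copula_hyperbola_measurable[OF assms sets_mu] .

lemma AE_le_max:
  assumes "\<Lambda> \<in> tail_copulas"
  shows "AE b in \<mu>. norm (\<Lambda> (b, 1 / b)) \<le> max_tail_copula (b, 1 / b)"
  using tail_copula_hyperbola_bounds(4)[OF assms] by (intro AE_I2) (simp add: space_mu)

lemma integrable_tail_copula:
  assumes "\<Lambda> \<in> tail_copulas"
  shows "integrable \<mu> (\<lambda>b. \<Lambda> (b, 1 / b))"
proof (rule Bochner_Integration.integrable_bound[OF integrable_max])
  show "AE b in \<mu>. norm (\<Lambda> (b, 1 / b)) \<le> norm (max_tail_copula (b, 1 / b))"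
    using AE_le_max[OF assms] by eventually_elim simp
qed (rule measurable_tail_copula[OF assms])

text \<open>The integrand is positive at every \<open>b > 0\<close>; a zero integral would make it
  vanish almost everywhere, which is absurd on a probability space.\<close>

lemma integral_max_pos: "0 < (\<integral> b. max_tail_copula (b, 1 / b) \<partial>\<mu>)"
proof (rule ccontr)
  assume neg: "\<not> ?thesis"
  have nonneg: "AE b in \<mu>. 0 \<le> max_tail_copula (b, 1 / b)"
    by (intro AE_I2) (simp add: space_mu max_tail_copula_hyperbola)
  with neg have "(\<integral> b. max_tail_copula (b, 1 / b) \<partial>\<mu>) = 0"
    using integral_nonneg_AE[OF nonneg] by simp
  then have "AE b in \<mu>. max_tail_copula (b, 1 / b) = 0"
    using integral_nonneg_eq_0_iff_AE[OF integrable_max nonneg] by simp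
  then have "AE b in \<mu>. False"
    by (rule AE_mp) (intro AE_I2, simp add: space_mu max_tail_copula_hyperbola min_def)
  then show False by simp
qed

lemma lambda_avg_nonneg:
  assumes "\<Lambda> \<in> tail_copulas"
  shows "0 \<le> lambda_avg \<mu> \<Lambda>"
  unfolding lambda_avg_def
  by (intro divide_nonneg_pos integral_max_pos integral_nonneg_AE AE_I2)
    (simp add: space_mu tail_copula_hyperbola_bounds(1)[OF assms])

lemma lambda_avg_tcm: "tcm (lambda_avg \<mu>)"
  unfolding tcm_def
proof (intro conjI ballI allI impI)
  fix \<Lambda> assume "\<Lambda> \<in> tail_copulas" "tail_comonotonic \<Lambda>"
  then show "lambda_avg \<mu> \<Lambda> = 1"
    using integral_max_pos by (simp add: lambda_avg_def tail_comonotonic_def)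
next
  fix \<Lambda> assume \<Lambda>: "\<Lambda> \<in> tail_copulas"
  have nonneg: "AE b in \<mu>. 0 \<le> \<Lambda> (b, 1 / b)"
    using tail_copula_hyperbola_bounds(1)[OF \<Lambda>] by (intro AE_I2) (simp add: space_mu)
  have "lambda_avg \<mu> \<Lambda> = 0 \<longleftrightarrow> (AE b in \<mu>. \<Lambda> (b, 1 / b) = 0)"
    using integral_nonneg_eq_0_iff_AE[OF integrable_tail_copula[OF \<Lambda>] nonneg] integral_max_pos
    by (simp add: lambda_avg_def)
  also have "\<dots> \<longleftrightarrow> tail_independent \<Lambda>"
  proof
    assume "AE b in \<mu>. \<Lambda> (b, 1 / b) = 0"
    \<comment> \<open>One zero on the hyperbola suffices, so the almost-everywhere statement loses
      its dependence on \<open>b\<close> and holds outright under a probability measure.\<close>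
    then have "AE b in \<mu>. tail_independent \<Lambda>"
      by (rule AE_mp) (intro AE_I2 impI tail_copula_eq_0_of_hyperbola \<Lambda>, auto simp: space_mu)
    then show "tail_independent \<Lambda>" by simp
  next
    assume "tail_independent \<Lambda>"
    then show "AE b in \<mu>. \<Lambda> (b, 1 / b) = 0"
      by (intro AE_I2) (simp add: space_mu tail_independent_def quadrant_def)
  qed
  finally show "lambda_avg \<mu> \<Lambda> = 0 \<longleftrightarrow> tail_independent \<Lambda>" .
next
  fix \<Lambda> \<Lambda>' assume "\<Lambda> \<in> tail_copulas" "\<Lambda>' \<in> tail_copulas" "tail_le \<Lambda> \<Lambda>'"
  then show "lambda_avg \<mu> \<Lambda> \<le> lambda_avg \<mu> \<Lambda>'"
    unfolding lambda_avg_def using integral_max_pos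
    by (intro divide_right_mono integral_mono integrable_tail_copula)
      (auto simp: tail_le_def quadrant_def space_mu)
next
  fix \<Lambda>n :: "nat \<Rightarrow> real \<times> real \<Rightarrow> real" and \<Lambda>
  assume \<Lambda>: "\<Lambda> \<in> tail_copulas" "\<forall>n. \<Lambda>n n \<in> tail_copulas"
    and lim: "\<forall>x\<in>quadrant. (\<lambda>n. \<Lambda>n n x) \<longlonglongrightarrow> \<Lambda> x"
  have "(\<lambda>n. \<integral> b. \<Lambda>n n (b, 1 / b) \<partial>\<mu>) \<longlonglongrightarrow> (\<integral> b. \<Lambda> (b, 1 / b) \<partial>\<mu>)"
  proof (rule integral_dominated_convergence[OF _ _ integrable_max])
    show "AE b in \<mu>. (\<lambda>n. \<Lambda>n n (b, 1 / b)) \<longlonglongrightarrow> \<Lambda> (b, 1 / b)"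
      using lim by (intro AE_I2) (auto simp: space_mu quadrant_def)
  qed (use \<Lambda> measurable_tail_copula AE_le_max in auto)
  then show "(\<lambda>n. lambda_avg \<mu> (\<Lambda>n n)) \<longlonglongrightarrow> lambda_avg \<mu> \<Lambda>"
    unfolding lambda_avg_def using integral_max_pos by (intro tendsto_divide tendsto_const) auto
qed

text \<open>Linearity of the integral gives equality, hence convexity and concavity
  together.\<close>

lemma lambda_avg_tail_mix:
  assumes "\<Lambda> \<in> tail_copulas" "\<Lambda>' \<in> tail_copulas"
  shows "lambda_avg \<mu> (tail_mix t \<Lambda> \<Lambda>') = t * lambda_avg \<mu> \<Lambda> + (1 - t) * lambda_avg \<mu> \<Lambda>'"
proof -
  have "(\<integral> b. tail_mix t \<Lambda> \<Lambda>' (b, 1 / b) \<partial>\<mu>) =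
      (\<integral> b. t * \<Lambda> (b, 1 / b) + (1 - t) * \<Lambda>' (b, 1 / b) \<partial>\<mu>)"
    by (intro Bochner_Integration.integral_cong) (auto simp: space_mu tail_mix_hyperbola)
  also have "\<dots> = t * (\<integral> b. \<Lambda> (b, 1 / b) \<partial>\<mu>) + (1 - t) * (\<integral> b. \<Lambda>' (b, 1 / b) \<partial>\<mu>)"
    using assms integrable_tail_copula by simp
  finally show ?thesis
    by (simp add: lambda_avg_def add_divide_distrib)
qed

lemma lambda_avg_linear: "linear_tcm (lambda_avg \<mu>)"
  unfolding linear_tcm_def convex_tcm_def concave_tcm_def
  using lambda_avg_tcm by (simp add: lambda_avg_tail_mix)

text \<open>Equal integrals of ordered functions agree almost everywhere, hence at points
  \<open>b\<close> arbitrarily close to 1. There the square bound gives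
  \<open>(min b (1 / b))\<^sup>2 \<le> \<Lambda> (1, 1)\<close>, and the left side tends to
  1.\<close>

lemma lambda_avg_strict:
  assumes mass: "\<And>\<epsilon>. 0 < \<epsilon> \<Longrightarrow> 0 < measure \<mu> ({1 - \<epsilon><..<1 + \<epsilon>} \<inter> {0<..})"
  shows "strict_tcm (lambda_avg \<mu>)"
  unfolding strict_tcm_def
proof (intro conjI ballI iffI)
  fix \<Lambda> assume \<Lambda>: "\<Lambda> \<in> tail_copulas" "lambda_avg \<mu> \<Lambda> = 1"
  let ?d = "\<lambda>b. max_tail_copula (b, 1 / b) - \<Lambda> (b, 1 / b)"
  have "(\<integral> b. \<Lambda> (b, 1 / b) \<partial>\<mu>) = (\<integral> b. max_tail_copula (b, 1 / b) \<partial>\<mu>)"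
    using \<Lambda>(2) integral_max_pos by (simp add: lambda_avg_def)
  then have "(\<integral> b. ?d b \<partial>\<mu>) = 0"
    using integrable_max integrable_tail_copula[OF \<Lambda>(1)] by simp
  moreover have "AE b in \<mu>. 0 \<le> ?d b"
    using AE_le_max[OF \<Lambda>(1)] by eventually_elim auto
  ultimately have eq: "AE b in \<mu>. ?d b = 0"
    using integral_nonneg_eq_0_iff_AE[of \<mu> ?d] integrable_max integrable_tail_copula[OF \<Lambda>(1)]
    by simp
  \<comment> \<open>Otherwise the interval around 1 would lie in the null set where the two
    functions differ, against \<open>mass\<close>.\<close>
  have near: "\<exists>b. 0 < b \<and> \<bar>b - 1\<bar> < \<epsilon> \<and> \<Lambda> (b, 1 / b) = min b (1 / b)" if "0 < \<epsilon>" for \<epsilon> :: real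
  proof (rule ccontr)
    assume none: "\<not> ?thesis"
    have "AE b in \<mu>. b \<notin> {1 - \<epsilon><..<1 + \<epsilon>} \<inter> {0<..}"
      using eq
    proof (rule AE_mp, intro AE_I2 impI)
      fix b assume b: "b \<in> space \<mu>" "?d b = 0"
      then have "\<Lambda> (b, 1 / b) = min b (1 / b)"
        by (simp add: space_mu max_tail_copula_hyperbola)
      with none b have "\<not> \<bar>b - 1\<bar> < \<epsilon>" by (auto simp: space_mu)
      then show "b \<notin> {1 - \<epsilon><..<1 + \<epsilon>} \<inter> {0<..}" by auto
    qed
    moreover have "{1 - \<epsilon><..<1 + \<epsilon>} \<inter> {0<..} \<in> events"
      by (auto simp: sets_mu sets_restrict_space)
    ultimately have "measure \<mu> ({1 - \<epsilon><..<1 + \<epsilon>} \<inter> {0<..}) = 0"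
      by (simp add: prob_eq_0)
    with mass[OF that] show False by simp
  qed
  have "1 \<le> \<Lambda> (1, 1)"
  proof (rule ccontr)
    assume less: "\<not> ?thesis"
    have "((\<lambda>b. (min b (1 / b))\<^sup>2) \<longlongrightarrow> (min 1 (1 / 1))\<^sup>2) (nhds (1 :: real))"
      by (intro tendsto_intros filterlim_ident) auto
    then have "\<forall>\<^sub>F b in nhds 1. \<Lambda> (1, 1) < (min b (1 / b))\<^sup>2"
      by (rule order_tendstoD) (use less in auto)
    then obtain \<epsilon> where "0 < \<epsilon>" and \<epsilon>: "\<And>b. dist b 1 < \<epsilon> \<Longrightarrow> \<Lambda> (1, 1) < (min b (1 / b))\<^sup>2"
      unfolding eventually_nhds_metric by blast
    then obtain b where "0 < b" "\<bar>b - 1\<bar> < \<epsilon>" "\<Lambda> (b, 1 / b) = min b (1 / b)"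
      using near by blast
    with \<epsilon>[of b] tail_copula_sq_le_diagonal[OF \<Lambda>(1), of b] show False
      by (simp add: dist_real_def)
  qed
  then show "\<Lambda> = max_tail_copula"
    by (rule tail_copula_eq_max_of_diagonal[OF \<Lambda>(1)])
next
  fix \<Lambda> assume "\<Lambda> \<in> tail_copulas" "\<Lambda> = max_tail_copula"
  then show "lambda_avg \<mu> \<Lambda> = 1"
    using lambda_avg_tcm by (auto simp: tcm_def tail_comonotonic_def)
qed (rule lambda_avg_tcm)

end

text \<open>The conjuncts on boundedness, integrability and the positive denominator certify that
  \<open>SUP\<close>, the Bochner integral and the quotient are genuine values and not
  defaults.\<close>

theorem proposition3p7:
  shows "((\<forall>\<Lambda>\<in>tail_copulas. bdd_above ((\<lambda>b. \<Lambda> (b, 1 / b)) ` {0<..})) \<and>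
          lambda_max \<in> tail_copulas \<rightarrow> {0..} \<and>
          strict_tcm lambda_max \<and> convex_tcm lambda_max) \<and>
         (\<forall>\<mu>\<in>averaging_measures.
            (\<forall>\<Lambda>\<in>tail_copulas. integrable \<mu> (\<lambda>b. \<Lambda> (b, 1 / b))) \<and>
            (\<integral> b. max_tail_copula (b, 1 / b) \<partial>\<mu>) > 0 \<and>
            lambda_avg \<mu> \<in> tail_copulas \<rightarrow> {0..} \<and>
            linear_tcm (lambda_avg \<mu>)) \<and>
         (\<forall>\<mu>\<in>averaging_measures.
            (\<forall>\<epsilon>>0. measure \<mu> ({1 - \<epsilon><..<1 + \<epsilon>} \<inter> {0<..}) > 0) \<longrightarrow>
            strict_tcm (lambda_avg \<mu>))"
proof (intro conjI ballI impI funcsetI)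
  fix \<mu> :: "real measure" assume "\<mu> \<in> averaging_measures"
  then interpret averaging \<mu> by unfold_locales
  show "integrable \<mu> (\<lambda>b. \<Lambda> (b, 1 / b))" if "\<Lambda> \<in> tail_copulas" for \<Lambda>
    using integrable_tail_copula[OF that] .
  show "(\<integral> b. max_tail_copula (b, 1 / b) \<partial>\<mu>) > 0"
    by (rule integral_max_pos)
  show "lambda_avg \<mu> \<Lambda> \<in> {0..}" if "\<Lambda> \<in> tail_copulas" for \<Lambda>
    using lambda_avg_nonneg[OF that] by simp
  show "linear_tcm (lambda_avg \<mu>)"
    by (rule lambda_avg_linear)
  show "strict_tcm (lambda_avg \<mu>)"
    if "\<forall>\<epsilon>>0. measure \<mu> ({1 - \<epsilon><..<1 + \<epsilon>} \<inter> {0<..}) > 0"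
    using that by (intro lambda_avg_strict) auto
qed (auto intro: bdd_above_tail_copula_hyperbola lambda_max_nonneg lambda_max_strict
    lambda_max_convex)

end
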